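(* Let $k$ be a commutative, associative, unital ring and let $G$ be a finite group. Then the group ring $kG$ is self-dual.
   Context: An associative $k$-algebra $A$, free of finite rank as a $k$-module, is self-dual if it admits a dualizing form, i.e. a $k$-bilinear form $\langle-,-\rangle:A\times A\to k$ for which the associated $k$-linear map $A\to A^{\vee}=\operatorname{Hom}_k(A,k)$, $a\mapsto\langle a,-\rangle$, is an isomorphism and which satisfies $\langle ac,b\rangle=\langle a,cb\rangle$ and $\langle ca,b\rangle=\langle a,bc\rangle$ for all $a,b,c\in A$. Equivalently, there is an $A$-bimodule isomorphism $A\to A^{\vee\,\mathrm{op}}$, where $A^{\vee\,\mathrm{op}}$ is $A^\vee$ with the $A$-bimodule structure $(afb)(x)=f(bxa)$. *)

theory Defs
  imports "HOL-Algebra.Module"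
begin

section \<open>Associative algebras, free of finite rank\<close>

text \<open>The library locale \<^locale>\<open>algebra\<close> is for commutative algebras only.\<close>

locale assoc_algebra = module + ring M +
  assumes smult_mult_left:
      "\<lbrakk> r \<in> carrier R; x \<in> carrier M; y \<in> carrier M \<rbrakk> \<Longrightarrow>
        (r \<odot>\<^bsub>M\<^esub> x) \<otimes>\<^bsub>M\<^esub> y = r \<odot>\<^bsub>M\<^esub> (x \<otimes>\<^bsub>M\<^esub> y)"
    and smult_mult_right:
      "\<lbrakk> r \<in> carrier R; x \<in> carrier M; y \<in> carrier M \<rbrakk> \<Longrightarrow>
        x \<otimes>\<^bsub>M\<^esub> (r \<odot>\<^bsub>M\<^esub> y) = r \<odot>\<^bsub>M\<^esub> (x \<otimes>\<^bsub>M\<^esub> y)"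

text \<open>The basis is a family indexed by \<open>{..<n}\<close>; over the zero ring its members may coincide.\<close>

definition free_of_finite_rank ::
    "('a, 'r) ring_scheme \<Rightarrow> ('a, 'b, 'm) module_scheme \<Rightarrow> bool" where
  "free_of_finite_rank R M \<longleftrightarrow>
    (\<exists>(n::nat) b. b \<in> {..<n} \<rightarrow> carrier M \<and>
      (\<forall>x \<in> carrier M. \<exists>!c. c \<in> {..<n} \<rightarrow>\<^sub>E carrier R \<and>
        x = (\<Oplus>\<^bsub>M\<^esub>i\<in>{..<n}. c i \<odot>\<^bsub>M\<^esub> b i)))"


section \<open>Linear maps and the dual module\<close>

text \<open>Linear maps are extensional functions on the carrier, so that equality of maps is
  equality in HOL.\<close>

definition lin_maps ::
    "('a, 'r) ring_scheme \<Rightarrow> ('a, 'b, 'm) module_scheme \<Rightarrow> ('a, 'c, 'n) module_scheme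
      \<Rightarrow> ('b \<Rightarrow> 'c) set" where
  "lin_maps R M N = {f \<in> carrier M \<rightarrow>\<^sub>E carrier N.
    (\<forall>x \<in> carrier M. \<forall>y \<in> carrier M. f (x \<oplus>\<^bsub>M\<^esub> y) = f x \<oplus>\<^bsub>N\<^esub> f y) \<and>
    (\<forall>r \<in> carrier R. \<forall>x \<in> carrier M. f (r \<odot>\<^bsub>M\<^esub> x) = r \<odot>\<^bsub>N\<^esub> f x)}"

definition lin_isos ::
    "('a, 'r) ring_scheme \<Rightarrow> ('a, 'b, 'm) module_scheme \<Rightarrow> ('a, 'c, 'n) module_scheme
      \<Rightarrow> ('b \<Rightarrow> 'c) set" where
  "lin_isos R M N = {f \<in> lin_maps R M N. bij_betw f (carrier M) (carrier N)}"

definition regular_module :: "('a, 'r) ring_scheme \<Rightarrow> ('a, 'a) module" where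
  "regular_module R =
    \<lparr>carrier = carrier R, mult = mult R, one = one R, zero = zero R, add = add R,
     smult = mult R\<rparr>"

text \<open>The record type \<^typ>\<open>('a, 'b) module\<close> extends rings; the fields \<^const>\<open>mult\<close> and
  \<^const>\<open>one\<close> play no role for a module and are left unspecified.\<close>

definition dual_module ::
    "('a, 'r) ring_scheme \<Rightarrow> ('a, 'b, 'm) module_scheme \<Rightarrow> ('a, 'b \<Rightarrow> 'a) module" where
  "dual_module R M =
    \<lparr>carrier = lin_maps R M (regular_module R), mult = undefined, one = undefined,
     zero = (\<lambda>x \<in> carrier M. \<zero>\<^bsub>R\<^esub>),
     add = (\<lambda>f g. \<lambda>x \<in> carrier M. f x \<oplus>\<^bsub>R\<^esub> g x),
     smult = (\<lambda>r f. \<lambda>x \<in> carrier M. r \<otimes>\<^bsub>R\<^esub> f x)\<rparr>"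


section \<open>Self-dual algebras\<close>

definition bilinear_form ::
    "('a, 'r) ring_scheme \<Rightarrow> ('a, 'b, 'm) module_scheme \<Rightarrow> ('b \<Rightarrow> 'b \<Rightarrow> 'a) \<Rightarrow> bool" where
  "bilinear_form R A B \<longleftrightarrow>
    (\<forall>a \<in> carrier A. (\<lambda>b \<in> carrier A. B a b) \<in> lin_maps R A (regular_module R)) \<and>
    (\<forall>b \<in> carrier A. (\<lambda>a \<in> carrier A. B a b) \<in> lin_maps R A (regular_module R))"

definition dualizing_form ::
    "('a, 'r) ring_scheme \<Rightarrow> ('a, 'b, 'm) module_scheme \<Rightarrow> ('b \<Rightarrow> 'b \<Rightarrow> 'a) \<Rightarrow> bool" where
  "dualizing_form R A B \<longleftrightarrow>
    bilinear_form R A B \<and>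
    (\<lambda>a \<in> carrier A. \<lambda>b \<in> carrier A. B a b) \<in> lin_isos R A (dual_module R A) \<and>
    (\<forall>a \<in> carrier A. \<forall>b \<in> carrier A. \<forall>c \<in> carrier A.
      B (a \<otimes>\<^bsub>A\<^esub> c) b = B a (c \<otimes>\<^bsub>A\<^esub> b) \<and>
      B (c \<otimes>\<^bsub>A\<^esub> a) b = B a (b \<otimes>\<^bsub>A\<^esub> c))"

definition self_dual ::
    "('a, 'r) ring_scheme \<Rightarrow> ('a, 'b, 'm) module_scheme \<Rightarrow> bool" where
  "self_dual R A \<longleftrightarrow>
    assoc_algebra R A \<and> free_of_finite_rank R A \<and> (\<exists>B. dualizing_form R A B)"


section \<open>The group ring\<close>

text \<open>An element \<open>\<Sum>g. f g \<cdot> g\<close> of the group ring is represented by its finitely supported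
  coefficient function \<open>f\<close>. The coefficient of \<open>x\<close> in a product collects all factorizations
  \<open>x = y (y\<inverse> x)\<close>. The sum must be restricted to the support of \<open>f\<close>, because
  \<^const>\<open>finsum\<close> is zero over an infinite index set.\<close>

definition group_ring ::
    "('a, 'r) ring_scheme \<Rightarrow> ('g, 'm) monoid_scheme \<Rightarrow> ('a, 'g \<Rightarrow> 'a) module" where
  "group_ring R G =
    \<lparr>carrier = {f \<in> carrier G \<rightarrow>\<^sub>E carrier R. finite {g \<in> carrier G. f g \<noteq> \<zero>\<^bsub>R\<^esub>}},
     mult = (\<lambda>f h. \<lambda>x \<in> carrier G.
       \<Oplus>\<^bsub>R\<^esub>y\<in>{y \<in> carrier G. f y \<noteq> \<zero>\<^bsub>R\<^esub>}. f y \<otimes>\<^bsub>R\<^esub> h (inv\<^bsub>G\<^esub> y \<otimes>\<^bsub>G\<^esub> x)),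
     one = (\<lambda>x \<in> carrier G. if x = \<one>\<^bsub>G\<^esub> then \<one>\<^bsub>R\<^esub> else \<zero>\<^bsub>R\<^esub>),
     zero = (\<lambda>x \<in> carrier G. \<zero>\<^bsub>R\<^esub>),
     add = (\<lambda>f h. \<lambda>x \<in> carrier G. f x \<oplus>\<^bsub>R\<^esub> h x),
     smult = (\<lambda>r f. \<lambda>x \<in> carrier G. r \<otimes>\<^bsub>R\<^esub> f x)\<rparr>"

end

theory Submission
  imports Defs
begin

text \<open>The dualizing form is \<open>\<langle>a, b\<rangle> = (a b)(1) = \<Sum>y. a(y) b(y\<inverse>)\<close>, the coefficient of the unit
  in the product. It is symmetric, so both invariance identities reduce to associativity. The
  dual basis of \<open>(g)\<close> is \<open>(g\<inverse>)\<close>, hence the form identifies a linear functional \<open>f\<close> with the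
  element whose coefficient at \<open>y\<close> is \<open>f(y\<inverse>)\<close>.\<close>

section \<open>Interchange and substitution in finite sums\<close>

context abelian_monoid
begin

lemma finsum_swap:
  assumes "finite A" "finite B" "\<And>x y. x \<in> A \<Longrightarrow> y \<in> B \<Longrightarrow> f x y \<in> carrier G"
  shows "(\<Oplus>x\<in>A. \<Oplus>y\<in>B. f x y) = (\<Oplus>y\<in>B. \<Oplus>x\<in>A. f x y)"
  using assms
proof (induction A rule: finite_induct)
  case empty
  then show ?case by simp
next
  case (insert a A)
  have "(\<Oplus>y\<in>B. \<Oplus>x\<in>insert a A. f x y) = (\<Oplus>y\<in>B. f a y \<oplus> (\<Oplus>x\<in>A. f x y))"
    using insert by (intro finsum_cong') (auto simp: Pi_def intro!: finsum_closed)
  also have "\<dots> = (\<Oplus>y\<in>B. f a y) \<oplus> (\<Oplus>y\<in>B. \<Oplus>x\<in>A. f x y)"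
    using insert by (intro finsum_addf) (auto simp: Pi_def intro!: finsum_closed)
  finally show ?case
    using insert by (simp add: Pi_def)
qed

lemma finsum_reindex_bij_betw:
  assumes "bij_betw h A B" "f \<in> B \<rightarrow> carrier G"
  shows "(\<Oplus>x\<in>A. f (h x)) = (\<Oplus>y\<in>B. f y)"
  using finsum_reindex[of f h A] assms by (auto simp: bij_betw_def)

end

section \<open>Coefficient functions over a finite group\<close>

locale finite_group_ring = R: cring R + G: group G
  for R :: "('a, 'r) ring_scheme" (structure) and G :: "('g, 'm) monoid_scheme" (structure) +
  assumes finite_G: "finite (carrier G)"
begin

abbreviation A :: "('a, 'g \<Rightarrow> 'a) module" where
  "A \<equiv> group_ring R G"

text \<open>The group element \<open>g\<close> viewed inside the group ring. For \<open>g\<close>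
  outside \<open>carrier G\<close> this is the zero element, so \<open>single_closed\<close> holds
  for every \<open>g\<close>.\<close>

definition single :: "'g \<Rightarrow> 'g \<Rightarrow> 'a" where
  "single g = (\<lambda>x \<in> carrier G. if x = g then \<one> else \<zero>)"

text \<open>A subset of a finite group is finite, so the support condition holds for every
  coefficient function.\<close>

lemma carrier_A: "carrier A = carrier G \<rightarrow>\<^sub>E carrier R"
  using finite_G by (auto simp: group_ring_def)

lemma coeff_closed [simp, intro]: "f \<in> carrier A \<Longrightarrow> x \<in> carrier G \<Longrightarrow> f x \<in> carrier R"
  by (auto simp: carrier_A)

lemma A_eqI:
  "f \<in> carrier A \<Longrightarrow> h \<in> carrier A \<Longrightarrow> (\<And>x. x \<in> carrier G \<Longrightarrow> f x = h x) \<Longrightarrow> f = h"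
  unfolding carrier_A by (rule PiE_ext)

lemma add_apply [simp]: "x \<in> carrier G \<Longrightarrow> (f \<oplus>\<^bsub>A\<^esub> h) x = f x \<oplus> h x"
  and zero_apply [simp]: "x \<in> carrier G \<Longrightarrow> \<zero>\<^bsub>A\<^esub> x = \<zero>"
  and smult_apply [simp]: "x \<in> carrier G \<Longrightarrow> (r \<odot>\<^bsub>A\<^esub> f) x = r \<otimes> f x"
  and one_eq_single: "\<one>\<^bsub>A\<^esub> = single \<one>\<^bsub>G\<^esub>"
  and single_apply [simp]: "x \<in> carrier G \<Longrightarrow> single g x = (if x = g then \<one> else \<zero>)"
  by (simp_all add: group_ring_def single_def)

lemma add_closed: "f \<in> carrier A \<Longrightarrow> h \<in> carrier A \<Longrightarrow> f \<oplus>\<^bsub>A\<^esub> h \<in> carrier A"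
  and zero_closed: "\<zero>\<^bsub>A\<^esub> \<in> carrier A"
  and smult_closed: "r \<in> carrier R \<Longrightarrow> f \<in> carrier A \<Longrightarrow> r \<odot>\<^bsub>A\<^esub> f \<in> carrier A"
  and single_closed: "single g \<in> carrier A"
  unfolding carrier_A by (auto simp: group_ring_def single_def)

lemma one_closed: "\<one>\<^bsub>A\<^esub> \<in> carrier A"
  by (simp add: one_eq_single single_closed)

text \<open>Terms outside the support of \<open>f\<close> vanish, so the sum may run over the whole
  finite group. The index set then no longer depends on \<open>f\<close>, and sums for different
  left factors can be compared termwise.\<close>

lemma mult_apply:
  assumes "f \<in> carrier A" "h \<in> carrier A" "x \<in> carrier G"
  shows "(f \<otimes>\<^bsub>A\<^esub> h) x = (\<Oplus>y\<in>carrier G. f y \<otimes> h (inv\<^bsub>G\<^esub> y \<otimes>\<^bsub>G\<^esub> x))"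
proof -
  have "(f \<otimes>\<^bsub>A\<^esub> h) x =
      (\<Oplus>y\<in>{y \<in> carrier G. f y \<noteq> \<zero>}. f y \<otimes> h (inv\<^bsub>G\<^esub> y \<otimes>\<^bsub>G\<^esub> x))"
    using assms by (simp add: group_ring_def)
  also have "\<dots> = (\<Oplus>y\<in>carrier G. f y \<otimes> h (inv\<^bsub>G\<^esub> y \<otimes>\<^bsub>G\<^esub> x))"
    using assms finite_G by (intro R.add.finprod_mono_neutral_cong_left) auto
  finally show ?thesis .
qed

lemma mult_closed:
  assumes "f \<in> carrier A" "h \<in> carrier A"
  shows "f \<otimes>\<^bsub>A\<^esub> h \<in> carrier A"
proof -
  have "(f \<otimes>\<^bsub>A\<^esub> h) x \<in> carrier R" if "x \<in> carrier G" for x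
    using assms that by (auto simp: mult_apply intro!: R.finsum_closed)
  moreover have "f \<otimes>\<^bsub>A\<^esub> h \<in> extensional (carrier G)"
    by (simp add: group_ring_def)
  ultimately show ?thesis
    by (auto simp: carrier_A PiE_def)
qed

section \<open>Permutations of the group and delta sums\<close>

lemma bij_betw_translate:
  assumes "g \<in> carrier G"
  shows "bij_betw (\<lambda>x. g \<otimes>\<^bsub>G\<^esub> x) (carrier G) (carrier G)"
  using assms by (simp add: bij_betw_def G.inj_on_cmult G.surj_const_mult)

lemma bij_betw_inv: "bij_betw (m_inv G) (carrier G) (carrier G)"
  by (rule bij_betw_byWitness[where f' = "m_inv G"]) auto

lemma finsum_delta_left:
  assumes "f \<in> carrier G \<rightarrow> carrier R" "g \<in> carrier G"
  shows "(\<Oplus>y\<in>carrier G. (if y = g then \<one> else \<zero>) \<otimes> f y) = f g"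
proof -
  have "(\<Oplus>y\<in>carrier G. (if y = g then \<one> else \<zero>) \<otimes> f y) =
      (\<Oplus>y\<in>carrier G. if y = g then f y else \<zero>)"
    using assms by (intro R.finsum_cong') (auto simp: Pi_iff)
  then show ?thesis
    using R.add.finprod_singleton_swap[of g "carrier G" f] assms finite_G by simp
qed

section \<open>The axioms of an associative algebra\<close>

lemma mult_assoc:
  assumes f: "f \<in> carrier A" and g: "g \<in> carrier A" and h: "h \<in> carrier A"
  shows "(f \<otimes>\<^bsub>A\<^esub> g) \<otimes>\<^bsub>A\<^esub> h = f \<otimes>\<^bsub>A\<^esub> (g \<otimes>\<^bsub>A\<^esub> h)"
proof (rule A_eqI)
  fix x assume x: "x \<in> carrier G"
  \<comment> \<open>Left translation by \<open>z\<close> permutes the group, so \<open>y\<close> may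
    be replaced by \<open>z w\<close>. Then \<open>z^-1 y\<close> becomes \<open>w\<close> and
    \<open>y^-1 x\<close> becomes \<open>w^-1 (z^-1 x)\<close>, which leaves a convolution of
    \<open>g\<close> and \<open>h\<close>.\<close>
  have inner: "(\<Oplus>y\<in>carrier G. g (inv\<^bsub>G\<^esub> z \<otimes>\<^bsub>G\<^esub> y) \<otimes> h (inv\<^bsub>G\<^esub> y \<otimes>\<^bsub>G\<^esub> x))
      = (g \<otimes>\<^bsub>A\<^esub> h) (inv\<^bsub>G\<^esub> z \<otimes>\<^bsub>G\<^esub> x)" if z: "z \<in> carrier G" for z
  proof -
    have cancel: "inv\<^bsub>G\<^esub> z \<otimes>\<^bsub>G\<^esub> (z \<otimes>\<^bsub>G\<^esub> w) = w" if "w \<in> carrier G" for w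
      using z that by (simp flip: G.m_assoc)
    have "(\<Oplus>y\<in>carrier G. g (inv\<^bsub>G\<^esub> z \<otimes>\<^bsub>G\<^esub> y) \<otimes> h (inv\<^bsub>G\<^esub> y \<otimes>\<^bsub>G\<^esub> x))
        = (\<Oplus>w\<in>carrier G. g (inv\<^bsub>G\<^esub> z \<otimes>\<^bsub>G\<^esub> (z \<otimes>\<^bsub>G\<^esub> w)) \<otimes>
            h (inv\<^bsub>G\<^esub> (z \<otimes>\<^bsub>G\<^esub> w) \<otimes>\<^bsub>G\<^esub> x))"
      using g h x z
      by (intro R.finsum_reindex_bij_betw[OF bij_betw_translate, symmetric]) auto
    also have "\<dots> = (\<Oplus>w\<in>carrier G. g w \<otimes> h (inv\<^bsub>G\<^esub> w \<otimes>\<^bsub>G\<^esub> (inv\<^bsub>G\<^esub> z \<otimes>\<^bsub>G\<^esub> x)))"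
      using g h x z
      by (intro R.finsum_cong') (auto simp: G.inv_mult_group G.m_assoc cancel)
    finally show ?thesis
      using g h x z by (simp add: mult_apply)
  qed
  have "((f \<otimes>\<^bsub>A\<^esub> g) \<otimes>\<^bsub>A\<^esub> h) x = (\<Oplus>y\<in>carrier G.
      (\<Oplus>z\<in>carrier G. f z \<otimes> g (inv\<^bsub>G\<^esub> z \<otimes>\<^bsub>G\<^esub> y)) \<otimes> h (inv\<^bsub>G\<^esub> y \<otimes>\<^bsub>G\<^esub> x))"
    using f g h x
    by (auto simp: mult_apply mult_closed intro!: R.finsum_cong' R.finsum_closed R.m_closed)
  also have "\<dots> = (\<Oplus>y\<in>carrier G. \<Oplus>z\<in>carrier G.
      f z \<otimes> (g (inv\<^bsub>G\<^esub> z \<otimes>\<^bsub>G\<^esub> y) \<otimes> h (inv\<^bsub>G\<^esub> y \<otimes>\<^bsub>G\<^esub> x)))"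
    using f g h x finite_G
    by (intro R.finsum_cong')
      (auto simp: R.finsum_ldistr R.m_assoc Pi_def intro!: R.finsum_cong' R.finsum_closed)
  \<comment> \<open>With the summation over \<open>y\<close> innermost, \<open>f z\<close> factors
    out and \<open>inner\<close> applies for each fixed \<open>z\<close>.\<close>
  also have "\<dots> = (\<Oplus>z\<in>carrier G. \<Oplus>y\<in>carrier G.
      f z \<otimes> (g (inv\<^bsub>G\<^esub> z \<otimes>\<^bsub>G\<^esub> y) \<otimes> h (inv\<^bsub>G\<^esub> y \<otimes>\<^bsub>G\<^esub> x)))"
    using f g h x finite_G by (intro R.finsum_swap) auto
  also have "\<dots> = (\<Oplus>z\<in>carrier G. f z \<otimes> (g \<otimes>\<^bsub>A\<^esub> h) (inv\<^bsub>G\<^esub> z \<otimes>\<^bsub>G\<^esub> x))"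
    using f g h x finite_G
    by (intro R.finsum_cong')
      (auto simp: R.finsum_rdistr[symmetric] Pi_def inner mult_closed)
  also have "\<dots> = (f \<otimes>\<^bsub>A\<^esub> (g \<otimes>\<^bsub>A\<^esub> h)) x"
    using f g h x by (simp add: mult_apply mult_closed)
  finally show "((f \<otimes>\<^bsub>A\<^esub> g) \<otimes>\<^bsub>A\<^esub> h) x = (f \<otimes>\<^bsub>A\<^esub> (g \<otimes>\<^bsub>A\<^esub> h)) x" .
qed (use assms in \<open>auto intro: mult_closed\<close>)

lemma one_mult:
  assumes "f \<in> carrier A"
  shows "\<one>\<^bsub>A\<^esub> \<otimes>\<^bsub>A\<^esub> f = f"
proof (rule A_eqI)
  fix x assume "x \<in> carrier G"
  then show "(\<one>\<^bsub>A\<^esub> \<otimes>\<^bsub>A\<^esub> f) x = f x"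
    using assms finsum_delta_left[of "\<lambda>y. f (inv\<^bsub>G\<^esub> y \<otimes>\<^bsub>G\<^esub> x)" "\<one>\<^bsub>G\<^esub>"]
    by (simp add: one_eq_single mult_apply single_closed Pi_def cong: R.finsum_cong)
qed (use assms in \<open>auto simp: one_eq_single intro: mult_closed single_closed\<close>)

lemma mult_one:
  assumes f: "f \<in> carrier A"
  shows "f \<otimes>\<^bsub>A\<^esub> \<one>\<^bsub>A\<^esub> = f"
proof (rule A_eqI)
  fix x assume x: "x \<in> carrier G"
  \<comment> \<open>As a function of \<open>y\<close>, the unit evaluated at \<open>y^-1 x\<close>
    is a delta concentrated at \<open>x\<close>, so the convolution collapses by
    \<open>finsum_delta_left\<close>.\<close>
  have eq: "inv\<^bsub>G\<^esub> y \<otimes>\<^bsub>G\<^esub> x = \<one>\<^bsub>G\<^esub> \<longleftrightarrow> y = x" if "y \<in> carrier G" for y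
    using x that by (auto simp: G.inv_solve_left')
  have "(f \<otimes>\<^bsub>A\<^esub> \<one>\<^bsub>A\<^esub>) x = (\<Oplus>y\<in>carrier G. (if y = x then \<one> else \<zero>) \<otimes> f y)"
    unfolding mult_apply[OF f single_closed x] one_eq_single
    using f x by (intro R.finsum_cong') (auto simp: eq)
  also have "\<dots> = f x"
    using f x by (intro finsum_delta_left) auto
  finally show "(f \<otimes>\<^bsub>A\<^esub> \<one>\<^bsub>A\<^esub>) x = f x" .
qed (use assms in \<open>auto simp: one_eq_single intro: mult_closed single_closed\<close>)

lemma abelian_group_A: "abelian_group A"
proof (rule abelian_groupI)
  fix f assume f: "f \<in> carrier A"
  define f' where "f' = (\<lambda>x\<in>carrier G. \<ominus> f x)"
  have "f' \<in> carrier A"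
    using f by (auto simp: carrier_A f'_def)
  moreover have "f' \<oplus>\<^bsub>A\<^esub> f = \<zero>\<^bsub>A\<^esub>"
    using f \<open>f' \<in> carrier A\<close>
    by (intro A_eqI) (auto simp: add_closed zero_closed f'_def R.l_neg)
  ultimately show "\<exists>h\<in>carrier A. h \<oplus>\<^bsub>A\<^esub> f = \<zero>\<^bsub>A\<^esub>" by blast
qed (auto intro!: A_eqI add_closed zero_closed simp: R.a_ac)

lemma distrib_right:
  assumes "f \<in> carrier A" "g \<in> carrier A" "h \<in> carrier A"
  shows "(f \<oplus>\<^bsub>A\<^esub> g) \<otimes>\<^bsub>A\<^esub> h = f \<otimes>\<^bsub>A\<^esub> h \<oplus>\<^bsub>A\<^esub> g \<otimes>\<^bsub>A\<^esub> h"
proof (rule A_eqI)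
  fix x assume x: "x \<in> carrier G"
  have "((f \<oplus>\<^bsub>A\<^esub> g) \<otimes>\<^bsub>A\<^esub> h) x = (\<Oplus>y\<in>carrier G.
      f y \<otimes> h (inv\<^bsub>G\<^esub> y \<otimes>\<^bsub>G\<^esub> x) \<oplus> g y \<otimes> h (inv\<^bsub>G\<^esub> y \<otimes>\<^bsub>G\<^esub> x))"
    unfolding mult_apply[OF add_closed[OF assms(1,2)] assms(3) x]
    using assms x by (intro R.finsum_cong') (auto simp: R.l_distr)
  also have "\<dots> = (f \<otimes>\<^bsub>A\<^esub> h \<oplus>\<^bsub>A\<^esub> g \<otimes>\<^bsub>A\<^esub> h) x"
    using assms x by (simp add: mult_apply)
  finally show "((f \<oplus>\<^bsub>A\<^esub> g) \<otimes>\<^bsub>A\<^esub> h) x = (f \<otimes>\<^bsub>A\<^esub> h \<oplus>\<^bsub>A\<^esub> g \<otimes>\<^bsub>A\<^esub> h) x" .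
qed (use assms in \<open>auto intro: mult_closed add_closed\<close>)

lemma distrib_left:
  assumes "f \<in> carrier A" "g \<in> carrier A" "h \<in> carrier A"
  shows "h \<otimes>\<^bsub>A\<^esub> (f \<oplus>\<^bsub>A\<^esub> g) = h \<otimes>\<^bsub>A\<^esub> f \<oplus>\<^bsub>A\<^esub> h \<otimes>\<^bsub>A\<^esub> g"
proof (rule A_eqI)
  fix x assume x: "x \<in> carrier G"
  have "(h \<otimes>\<^bsub>A\<^esub> (f \<oplus>\<^bsub>A\<^esub> g)) x = (\<Oplus>y\<in>carrier G.
      h y \<otimes> f (inv\<^bsub>G\<^esub> y \<otimes>\<^bsub>G\<^esub> x) \<oplus> h y \<otimes> g (inv\<^bsub>G\<^esub> y \<otimes>\<^bsub>G\<^esub> x))"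
    unfolding mult_apply[OF assms(3) add_closed[OF assms(1,2)] x]
    using assms x by (intro R.finsum_cong') (auto simp: R.r_distr)
  also have "\<dots> = (h \<otimes>\<^bsub>A\<^esub> f \<oplus>\<^bsub>A\<^esub> h \<otimes>\<^bsub>A\<^esub> g) x"
    using assms x by (simp add: mult_apply)
  finally show "(h \<otimes>\<^bsub>A\<^esub> (f \<oplus>\<^bsub>A\<^esub> g)) x = (h \<otimes>\<^bsub>A\<^esub> f \<oplus>\<^bsub>A\<^esub> h \<otimes>\<^bsub>A\<^esub> g) x" .
qed (use assms in \<open>auto intro: mult_closed add_closed\<close>)

text \<open>Both identities are checked termwise once \<open>r\<close> is distributed over the
  convolution sum. When the scalar sits on the right factor it has to move past \<open>f y\<close>,
  which uses commutativity of \<open>R\<close>.\<close>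

lemma smult_mult:
  assumes "r \<in> carrier R" "f \<in> carrier A" "h \<in> carrier A"
  shows "(r \<odot>\<^bsub>A\<^esub> f) \<otimes>\<^bsub>A\<^esub> h = r \<odot>\<^bsub>A\<^esub> (f \<otimes>\<^bsub>A\<^esub> h)"
    and "f \<otimes>\<^bsub>A\<^esub> (r \<odot>\<^bsub>A\<^esub> h) = r \<odot>\<^bsub>A\<^esub> (f \<otimes>\<^bsub>A\<^esub> h)"
proof -
  have "((r \<odot>\<^bsub>A\<^esub> f) \<otimes>\<^bsub>A\<^esub> h) x = (r \<odot>\<^bsub>A\<^esub> (f \<otimes>\<^bsub>A\<^esub> h)) x"
    and "(f \<otimes>\<^bsub>A\<^esub> (r \<odot>\<^bsub>A\<^esub> h)) x = (r \<odot>\<^bsub>A\<^esub> (f \<otimes>\<^bsub>A\<^esub> h)) x" if x: "x \<in> carrier G" for x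
  proof -
    have *: "(r \<odot>\<^bsub>A\<^esub> (f \<otimes>\<^bsub>A\<^esub> h)) x =
        (\<Oplus>y\<in>carrier G. r \<otimes> (f y \<otimes> h (inv\<^bsub>G\<^esub> y \<otimes>\<^bsub>G\<^esub> x)))"
      using assms x finite_G by (simp add: mult_apply R.finsum_rdistr Pi_def)
    show "((r \<odot>\<^bsub>A\<^esub> f) \<otimes>\<^bsub>A\<^esub> h) x = (r \<odot>\<^bsub>A\<^esub> (f \<otimes>\<^bsub>A\<^esub> h)) x"
      unfolding * mult_apply[OF smult_closed[OF assms(1,2)] assms(3) x]
      using assms x by (intro R.finsum_cong') (auto simp: R.m_assoc)
    show "(f \<otimes>\<^bsub>A\<^esub> (r \<odot>\<^bsub>A\<^esub> h)) x = (r \<odot>\<^bsub>A\<^esub> (f \<otimes>\<^bsub>A\<^esub> h)) x"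
      unfolding * mult_apply[OF assms(2) smult_closed[OF assms(1,3)] x]
      using assms x by (intro R.finsum_cong') (auto simp: R.m_lcomm)
  qed
  then show "(r \<odot>\<^bsub>A\<^esub> f) \<otimes>\<^bsub>A\<^esub> h = r \<odot>\<^bsub>A\<^esub> (f \<otimes>\<^bsub>A\<^esub> h)"
    and "f \<otimes>\<^bsub>A\<^esub> (r \<odot>\<^bsub>A\<^esub> h) = r \<odot>\<^bsub>A\<^esub> (f \<otimes>\<^bsub>A\<^esub> h)"
    using assms by (auto intro!: A_eqI mult_closed smult_closed)
qed

lemma assoc_algebra_A: "assoc_algebra R A"
proof -
  have "module R A"
    using abelian_group_A
    by (intro moduleI R.is_cring)
      (auto intro!: A_eqI add_closed smult_closed simp: R.l_distr R.r_distr R.m_assoc)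
  moreover have "monoid A"
    by (intro monoidI) (auto simp: mult_assoc one_mult mult_one mult_closed one_closed)
  then have "ring A"
    using abelian_group_A by (intro ringI) (auto simp: distrib_left distrib_right)
  ultimately show ?thesis
    by (intro assoc_algebra.intro assoc_algebra_axioms.intro) (auto simp: smult_mult)
qed

text \<open>Makes the facts about finite sums in the additive group of the group ring available for
  the basis expansions below.\<close>

sublocale A: assoc_algebra R A
  by (rule assoc_algebra_A)

section \<open>Group elements as a basis\<close>

lemma finsum_apply:
  assumes "finite I" "\<And>i. i \<in> I \<Longrightarrow> F i \<in> carrier A" "x \<in> carrier G"
  shows "(\<Oplus>\<^bsub>A\<^esub>i\<in>I. F i) x = (\<Oplus>i\<in>I. F i x)"
  using assms by (induction I rule: finite_induct) (auto simp: Pi_def)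

text \<open>Evaluation is additive, and by injectivity of \<open>e\<close> only the summand
  \<open>j = i\<close> survives at \<open>e i\<close>. The index set stays abstract to serve two
  cases: the identity on the group in \<open>single_expansion\<close>, and a numbering of the group
  in \<open>free_A\<close>.\<close>

lemma sum_singles:
  assumes e: "bij_betw e I (carrier G)" and c: "c \<in> I \<rightarrow> carrier R" and i: "i \<in> I"
  shows "(\<Oplus>\<^bsub>A\<^esub>j\<in>I. c j \<odot>\<^bsub>A\<^esub> single (e j)) (e i) = c i"
proof -
  have fin: "finite I"
    using e finite_G bij_betw_finite by blast
  have eG: "e j \<in> carrier G" if "j \<in> I" for j
    using e that by (auto simp: bij_betw_def)
  have "(\<Oplus>\<^bsub>A\<^esub>j\<in>I. c j \<odot>\<^bsub>A\<^esub> single (e j)) (e i) = (\<Oplus>j\<in>I. (c j \<odot>\<^bsub>A\<^esub> single (e j)) (e i))"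
    using c eG i by (intro finsum_apply fin) (auto simp: smult_closed single_closed)
  also have "\<dots> = (\<Oplus>j\<in>I. if j = i then c j else \<zero>)"
    using c eG i e by (intro R.finsum_cong') (auto simp: Pi_iff bij_betw_def inj_on_def)
  also have "\<dots> = c i"
    using R.add.finprod_singleton_swap[OF i fin c] by simp
  finally show ?thesis .
qed

lemma single_expansion:
  assumes "f \<in> carrier A"
  shows "(\<Oplus>\<^bsub>A\<^esub>g\<in>carrier G. f g \<odot>\<^bsub>A\<^esub> single g) = f"
proof (rule A_eqI)
  fix x assume "x \<in> carrier G"
  then show "(\<Oplus>\<^bsub>A\<^esub>g\<in>carrier G. f g \<odot>\<^bsub>A\<^esub> single g) x = f x"
    using assms sum_singles[of "\<lambda>x. x" "carrier G" f x]
    by (auto simp: bij_betw_def)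
qed (use assms in \<open>auto intro!: A.M.finsum_closed smult_closed single_closed\<close>)

lemma free_A: "free_of_finite_rank R A"
proof -
  obtain e where e: "bij_betw e {..<card (carrier G)} (carrier G)"
    using ex_bij_betw_nat_finite[OF finite_G] by (auto simp: atLeast0LessThan)
  let ?I = "{..<card (carrier G)}"
  let ?S = "\<lambda>c. \<Oplus>\<^bsub>A\<^esub>i\<in>?I. c i \<odot>\<^bsub>A\<^esub> single (e i)"
  have eG: "e j \<in> carrier G" if "j \<in> ?I" for j
    using e that by (auto simp: bij_betw_def)
  have "\<exists>!c. c \<in> ?I \<rightarrow>\<^sub>E carrier R \<and> x = ?S c" if x: "x \<in> carrier A" for x
  proof (rule ex1I)
    \<comment> \<open>By \<open>sum_singles\<close> the coordinate at \<open>i\<close> can only be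
      the coefficient of \<open>x\<close> at \<open>e i\<close>. It is restricted to the index set
      because freeness asks for uniqueness among extensional families.\<close>
    let ?c = "\<lambda>i\<in>?I. x (e i)"
    have c: "?c \<in> ?I \<rightarrow>\<^sub>E carrier R"
      using x eG by auto
    have "x = ?S ?c"
    proof (rule A_eqI[OF x])
      show "?S ?c \<in> carrier A"
        using c by (intro A.M.finsum_closed) (auto simp: x eG smult_closed single_closed)
      fix y assume "y \<in> carrier G"
      then obtain i where i: "i \<in> ?I" "y = e i"
        using e by (auto simp: bij_betw_def)
      have "?S ?c (e i) = ?c i"
        using c by (intro sum_singles[OF e _ i(1)]) auto
      moreover have "?c i = x y"
        using i by simp
      ultimately show "x y = ?S ?c y"
        unfolding i(2) by (rule sym[OF trans])
    qed
    with c show "?c \<in> ?I \<rightarrow>\<^sub>E carrier R \<and> x = ?S ?c" by blast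
    \<comment> \<open>Evaluating any other expansion at \<open>e i\<close> recovers
      \<open>d i\<close>, which forces \<open>d\<close> to be the family chosen above.\<close>
    fix d assume d: "d \<in> ?I \<rightarrow>\<^sub>E carrier R \<and> x = ?S d"
    then have "x (e i) = d i" if "i \<in> ?I" for i
      using sum_singles[OF e _ that, of d] by auto
    then show "d = ?c"
      using d c by (intro PiE_ext[of d ?I _ ?c]) auto
  qed
  moreover have "(\<lambda>i. single (e i)) \<in> ?I \<rightarrow> carrier A"
    by (simp add: single_closed)
  ultimately show ?thesis
    unfolding free_of_finite_rank_def
    by (intro exI[of _ "card (carrier G)"] exI[of _ "\<lambda>i. single (e i)"] conjI ballI)
qed

section \<open>The trace form\<close>

definition trace_form :: "('g \<Rightarrow> 'a) \<Rightarrow> ('g \<Rightarrow> 'a) \<Rightarrow> 'a" where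
  "trace_form a b = (a \<otimes>\<^bsub>A\<^esub> b) \<one>\<^bsub>G\<^esub>"

lemma trace_form_eq:
  assumes "a \<in> carrier A" "b \<in> carrier A"
  shows "trace_form a b = (\<Oplus>y\<in>carrier G. a y \<otimes> b (inv\<^bsub>G\<^esub> y))"
  unfolding trace_form_def using assms
  by (auto simp: mult_apply intro!: R.finsum_cong')

text \<open>Inversion permutes the group, and substituting \<open>y^-1\<close> for \<open>y\<close>
  exchanges the two arguments up to commuting each product in \<open>R\<close>. The algebra itself
  may be noncommutative; it is the coefficient at the unit that is symmetric.\<close>

lemma trace_form_sym:
  assumes "a \<in> carrier A" "b \<in> carrier A"
  shows "trace_form a b = trace_form b a"
proof -
  have "trace_form a b = (\<Oplus>y\<in>carrier G. a (inv\<^bsub>G\<^esub> y) \<otimes> b (inv\<^bsub>G\<^esub> (inv\<^bsub>G\<^esub> y)))"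
    unfolding trace_form_eq[OF assms] using assms
    by (intro R.finsum_reindex_bij_betw[OF bij_betw_inv, symmetric]) auto
  also have "\<dots> = trace_form b a"
    unfolding trace_form_eq[OF assms(2,1)] using assms
    by (intro R.finsum_cong') (auto simp: R.m_comm)
  finally show ?thesis .
qed

lemma trace_form_closed: "a \<in> carrier A \<Longrightarrow> b \<in> carrier A \<Longrightarrow> trace_form a b \<in> carrier R"
  by (simp add: trace_form_def mult_closed coeff_closed)

text \<open>These are the distributive laws evaluated at the unit: because the form is defined
  through the product, its bilinearity is inherited from the algebra axioms.\<close>

lemma trace_form_add:
  assumes "a \<in> carrier A" "b \<in> carrier A" "c \<in> carrier A"
  shows "trace_form (a \<oplus>\<^bsub>A\<^esub> b) c = trace_form a c \<oplus> trace_form b c"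
    and "trace_form c (a \<oplus>\<^bsub>A\<^esub> b) = trace_form c a \<oplus> trace_form c b"
  using assms by (simp_all add: trace_form_def distrib_left distrib_right)

lemma trace_form_smult:
  assumes "r \<in> carrier R" "a \<in> carrier A" "b \<in> carrier A"
  shows "trace_form (r \<odot>\<^bsub>A\<^esub> a) b = r \<otimes> trace_form a b"
    and "trace_form a (r \<odot>\<^bsub>A\<^esub> b) = r \<otimes> trace_form a b"
  using assms by (simp_all add: trace_form_def smult_mult)

text \<open>In the sum for the form, \<open>y^-1 = g^-1\<close> holds only at \<open>y = g\<close>.
  This duality gives injectivity of the map to the dual and dictates the representing element of a
  functional.\<close>

lemma trace_form_single:
  assumes a: "a \<in> carrier A" and g: "g \<in> carrier G"
  shows "trace_form a (single (inv\<^bsub>G\<^esub> g)) = a g"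
proof -
  have "trace_form a (single (inv\<^bsub>G\<^esub> g)) =
      (\<Oplus>y\<in>carrier G. (if y = g then \<one> else \<zero>) \<otimes> a y)"
    unfolding trace_form_eq[OF a single_closed] using a g
    by (intro R.finsum_cong') auto
  also have "\<dots> = a g"
    using a g by (intro finsum_delta_left) auto
  finally show ?thesis .
qed

section \<open>Linear functionals and their representation\<close>

lemma functional_finsum:
  assumes f: "f \<in> lin_maps R A (regular_module R)"
    and "finite I" "\<And>i. i \<in> I \<Longrightarrow> F i \<in> carrier A"
  shows "f (\<Oplus>\<^bsub>A\<^esub>i\<in>I. F i) = (\<Oplus>i\<in>I. f (F i))"
proof -
  have closed: "f x \<in> carrier R" if "x \<in> carrier A" for x
    using f that by (auto simp: lin_maps_def regular_module_def)
  have add: "f (x \<oplus>\<^bsub>A\<^esub> y) = f x \<oplus> f y" if "x \<in> carrier A" "y \<in> carrier A" for x y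
    using f that by (simp add: lin_maps_def regular_module_def)
  \<comment> \<open>The empty sum needs \<open>f\<close> to preserve zero. The definition of a
    linear map does not list this, so it is derived from homogeneity with the scalar zero.\<close>
  have "f (\<zero> \<odot>\<^bsub>A\<^esub> \<zero>\<^bsub>A\<^esub>) = \<zero> \<otimes> f \<zero>\<^bsub>A\<^esub>"
    using f zero_closed R.zero_closed unfolding lin_maps_def regular_module_def by fastforce
  then have zero: "f \<zero>\<^bsub>A\<^esub> = \<zero>"
    by (simp add: zero_closed closed)
  show ?thesis
    using assms(2,3)
  proof (induction I rule: finite_induct)
    case empty
    then show ?case
      by (simp add: zero)
  next
    case (insert i I)
    then show ?case
      by (simp add: Pi_def add closed)
  qed
qed

text \<open>A functional is determined by its values on the basis of group elements; this is what
  allows it to be matched with the trace form.\<close>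

lemma functional_expansion:
  assumes f: "f \<in> lin_maps R A (regular_module R)" and b: "b \<in> carrier A"
  shows "f b = (\<Oplus>g\<in>carrier G. b g \<otimes> f (single g))"
proof -
  have "f b = f (\<Oplus>\<^bsub>A\<^esub>g\<in>carrier G. b g \<odot>\<^bsub>A\<^esub> single g)"
    using b by (simp add: single_expansion)
  also have "\<dots> = (\<Oplus>g\<in>carrier G. f (b g \<odot>\<^bsub>A\<^esub> single g))"
    using b by (intro functional_finsum f finite_G) (auto simp: smult_closed single_closed)
  also have "\<dots> = (\<Oplus>g\<in>carrier G. b g \<otimes> f (single g))"
    using f b single_closed
    by (intro R.finsum_cong') (auto simp: lin_maps_def regular_module_def)
  finally show ?thesis .
qed

lemma trace_form_functional:
  assumes "a \<in> carrier A"
  shows "(\<lambda>b\<in>carrier A. trace_form a b) \<in> lin_maps R A (regular_module R)"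
    and "(\<lambda>b\<in>carrier A. trace_form b a) \<in> lin_maps R A (regular_module R)"
  using assms
  by (auto simp: lin_maps_def regular_module_def trace_form_closed trace_form_add
      trace_form_smult add_closed smult_closed)

lemma functional_represented:
  assumes f: "f \<in> lin_maps R A (regular_module R)"
  shows "\<exists>a\<in>carrier A. f = (\<lambda>b\<in>carrier A. trace_form a b)"
proof
  \<comment> \<open>This choice is forced: if \<open>a\<close> represents \<open>f\<close>, then
    \<open>trace_form_single\<close> says that \<open>a y\<close> is the value of \<open>f\<close>
    at \<open>single\<close> of \<open>y^-1\<close>.\<close>
  let ?a = "\<lambda>y\<in>carrier G. f (single (inv\<^bsub>G\<^esub> y))"
  have fR: "f b \<in> carrier R" if "b \<in> carrier A" for b
    using f that by (auto simp: lin_maps_def regular_module_def)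
  show a: "?a \<in> carrier A"
    using fR single_closed by (auto simp: carrier_A)
  have "f b = trace_form ?a b" if b: "b \<in> carrier A" for b
  proof -
    have "trace_form ?a b = (\<Oplus>y\<in>carrier G. b (inv\<^bsub>G\<^esub> y) \<otimes> f (single (inv\<^bsub>G\<^esub> y)))"
      unfolding trace_form_eq[OF a b] using b fR single_closed
      by (intro R.finsum_cong') (auto simp: R.m_comm)
    \<comment> \<open>Reindexing by inversion turns the sum for the form into the basis expansion of
      \<open>f b\<close>.\<close>
    also have "\<dots> = (\<Oplus>g\<in>carrier G. b g \<otimes> f (single g))"
      using b fR single_closed
      by (intro R.finsum_reindex_bij_betw[OF bij_betw_inv]) auto
    finally show ?thesis
      using functional_expansion[OF f b] by simp
  qed
  \<comment> \<open>Both sides are extensional on \<open>carrier A\<close>, so agreement there gives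
    equality of functions.\<close>
  then show "f = (\<lambda>b\<in>carrier A. trace_form ?a b)"
    using f by (intro extensionalityI[of _ "carrier A"]) (simp_all add: lin_maps_def PiE_def)
qed

section \<open>Nondegeneracy and invariance of the form\<close>

lemma dualizing_trace_form: "dualizing_form R A trace_form"
proof -
  let ?\<phi> = "\<lambda>a\<in>carrier A. \<lambda>b\<in>carrier A. trace_form a b"
  have "?\<phi> \<in> lin_maps R A (dual_module R A)"
    unfolding lin_maps_def[of R A "dual_module R A"] using trace_form_functional(1)
    by (auto simp: dual_module_def add_closed smult_closed trace_form_add
        trace_form_smult intro!: restrict_ext)
  \<comment> \<open>Equal functionals agree on all inverses of group elements, and these values are
    exactly the coefficients.\<close>
  moreover have "inj_on ?\<phi> (carrier A)"
  proof (rule inj_onI)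
    fix a b assume ab: "a \<in> carrier A" "b \<in> carrier A" "?\<phi> a = ?\<phi> b"
    show "a = b"
    proof (rule A_eqI[OF ab(1,2)])
      fix g assume "g \<in> carrier G"
      moreover have "?\<phi> a (single (inv\<^bsub>G\<^esub> g)) = ?\<phi> b (single (inv\<^bsub>G\<^esub> g))"
        using ab(3) by simp
      ultimately show "a g = b g"
        using ab single_closed by (simp add: trace_form_single)
    qed
  qed
  moreover have "?\<phi> ` carrier A = carrier (dual_module R A)"
    using trace_form_functional(1) functional_represented
    by (fastforce simp: dual_module_def)
  ultimately have "?\<phi> \<in> lin_isos R A (dual_module R A)"
    by (simp add: lin_isos_def bij_betw_def)
  moreover have "bilinear_form R A trace_form"
    using trace_form_functional by (simp add: bilinear_form_def)
  moreover have "trace_form (a \<otimes>\<^bsub>A\<^esub> c) b = trace_form a (c \<otimes>\<^bsub>A\<^esub> b)"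
    if "a \<in> carrier A" "b \<in> carrier A" "c \<in> carrier A" for a b c
    using that by (simp add: trace_form_def mult_assoc)
  \<comment> \<open>Symmetry reduces this to the previous identity:
    \<open><ca, b> = <b, ca> = <bc, a> = <a, bc>\<close>.\<close>
  moreover from this have "trace_form (c \<otimes>\<^bsub>A\<^esub> a) b = trace_form a (b \<otimes>\<^bsub>A\<^esub> c)"
    if "a \<in> carrier A" "b \<in> carrier A" "c \<in> carrier A" for a b c
    using that trace_form_sym mult_closed by metis
  ultimately show ?thesis
    by (simp add: dualizing_form_def)
qed

end

theorem mainTheorem4:
  fixes k :: "('a, 'r) ring_scheme" and G :: "('g, 'm) monoid_scheme"
  assumes "cring k" and "group G" and "finite (carrier G)"
  shows "self_dual k (group_ring k G)"
proof -
  interpret finite_group_ring k G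
    using assms by (intro finite_group_ring.intro finite_group_ring_axioms.intro)
  show ?thesis
    using assoc_algebra_A free_A dualizing_trace_form by (auto simp: self_dual_def)
qed

end
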